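(* Let $f:\mathbb{R}_+\times\mathbb{R}^n\to\mathbb{R}^n$ be continuously differentiable, let $t_0>0$, and consider the system $\Sigma:\ \dot x=f(t,x)$, $x(t_0)=x_0$, and its variational system, considered as a linear system, $$\delta\dot x=h(\delta x,t),\qquad h(\delta x,t)=\frac{\partial f}{\partial x}(t)\,\delta x,$$ (so that the Jacobian does not depend on $x$), with solution $\delta\psi(t,\delta x_0)$ on $t\ge t_0$ starting from $\delta x_0$ at $t_0$. Let $\phi\in C[\mathbb{R}_+\times\mathbb{R}^n,\mathbb{R}^n]$, $(t,u)\mapsto\phi(t,u)$, be quasi-monotone non-decreasing in $u\in\mathbb{R}^n$. Let $A=(a_{ij})_{n\times n}$ be a nonzero matrix with $a_{ij}\ge0$ for all $i,j$, and suppose that for any solution $\delta\psi(t)=\delta\psi(t,\delta x_0)$ of the variational system on $t\ge t_0$, $$2A\big(\delta\psi(t)\circ h(\delta\psi(t),t)\big)<\phi\big(t,\,A(\delta\psi(t)\circ\delta\psi(t))\big)\quad\text{for all }t\ge t_0.$$ Let $R(t)$, $t\ge t_0$, be a maximal solution of $$\dot u=\phi(t,u),\qquad u(t_0)=u_0\ge0.$$ Then any solution $\delta\psi(t)=\delta\psi(t,\delta x_0)$ of the variational system on $t\ge t_0$ which satisfies $A(\delta x_0\circ\delta x_0)<u_0$ has the property that $$A(\delta\psi(t)\circ\delta\psi(t))<R(t)\quad\text{for all }t\ge t_0.$$ Moreover, if $R(t)\to0$ as $t\to\infty$, then $\|\delta\psi(t)\|\to0$ as $t\to\infty$, and consequently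 all trajectories of $\Sigma$ converge with respect to one another as $t\to\infty$ (i.e. $\|x(t)-y(t)\|\to0$ for any two solutions $x,y$ of $\dot x=f(t,x)$).
   Context: Standing assumption: $\Sigma$ has a unique solution $\psi(t,x_0)$ for each initial state $x_0$. For $x,y\in\mathbb{R}^n$: $x\le y$ means $x_i\le y_i$ for all $i$; $x<y$ means $x_i<y_i$ for all $i$; $x\circ y=(x_1y_1,\dots,x_ny_n)^T$ is the componentwise product (the paper writes $\mathrm{dvec}(\mathrm{diag}(x)\,\mathrm{diag}(y))$); $\|\cdot\|$ is the Euclidean norm. $C[X,Y]$ is the set of continuous functions from $X$ to $Y$; $\mathbb{R}_+=[0,\infty)$. A continuous function $G=(G_1,\dots,G_n)$ on a nonempty subset of $\mathbb{R}^n$ is quasi-monotone non-decreasing if for each $i$, $G_i$ is nondecreasing in $u_j$ for all $j\ne i$. A solution $R(t)$ of an initial value problem is called a maximal solution if every solution $u(t)$ of that problem satisfies $u(t)\le R(t)$ for all $t\ge t_0$.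
   Formalization: The "Moreover" part additionally assumes that A has no zero column; for A merely nonzero it fails, e.g. f=(-x1,0), A=diag(1,0), φ_i=-u_i+e^{-t}, R_i=(1+t)e^{-t}, where δψ=(0,1) is constant. *)

theory Defs
  imports "HOL-Analysis.Analysis"
begin

text \<open>
  Vectors are elements of \<open>real ^ 'n\<close>. The library order \<open>\<le>\<close> and product \<open>*\<close> on this type are
  already componentwise. The library's strict order \<open><\<close> is not (it means \<open>\<le>\<close> and not \<open>\<ge>\<close>), hence
  the following relation.
\<close>

definition vec_less :: "real ^ 'n \<Rightarrow> real ^ 'n \<Rightarrow> bool"  (infix "\<lless>" 50)
  where "x \<lless> y \<longleftrightarrow> (\<forall>i. x $ i < y $ i)"

text \<open>
  Derivatives are taken within \<open>S\<close>, so that boundary points of \<open>S\<close> (such as time \<open>0\<close>) are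
  treated one-sidedly.
\<close>

definition continuously_differentiable_on ::
    "('a::real_normed_vector \<Rightarrow> 'b::real_normed_vector) \<Rightarrow> 'a set \<Rightarrow> bool"
  where "continuously_differentiable_on g S \<longleftrightarrow>
    (\<exists>g' :: 'a \<Rightarrow> 'a \<Rightarrow>\<^sub>L 'b.
       (\<forall>p\<in>S. (g has_derivative blinfun_apply (g' p)) (at p within S)) \<and> continuous_on S g')"

definition quasi_monotone :: "(real ^ 'n \<Rightarrow> real ^ 'n) \<Rightarrow> bool"
  where "quasi_monotone G \<longleftrightarrow>
    (\<forall>i j. j \<noteq> i \<longrightarrow> (\<forall>u. mono (\<lambda>s::real. G (\<chi> k. if k = j then s else u $ k) $ i)))"

text \<open>
  Solutions are functions on all of \<open>real\<close> of which only the values on \<open>{t0..}\<close> matter;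
  the derivative at \<open>t0\<close> is one-sided.
\<close>

definition ode_solution ::
    "(real \<Rightarrow> 'a \<Rightarrow> 'a) \<Rightarrow> real \<Rightarrow> (real \<Rightarrow> 'a::real_normed_vector) \<Rightarrow> bool"
  where "ode_solution F t0 x \<longleftrightarrow>
    (\<forall>t\<ge>t0. (x has_vector_derivative F t (x t)) (at t within {t0..}))"

definition ivp_solution ::
    "(real \<Rightarrow> 'a \<Rightarrow> 'a) \<Rightarrow> real \<Rightarrow> 'a \<Rightarrow> (real \<Rightarrow> 'a::real_normed_vector) \<Rightarrow> bool"
  where "ivp_solution F t0 x0 x \<longleftrightarrow> ode_solution F t0 x \<and> x t0 = x0"

definition maximal_solution ::
    "(real \<Rightarrow> real ^ 'n \<Rightarrow> real ^ 'n) \<Rightarrow> real \<Rightarrow> real ^ 'n \<Rightarrow> (real \<Rightarrow> real ^ 'n) \<Rightarrow> bool"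
  where "maximal_solution F t0 u0 R \<longleftrightarrow>
    ivp_solution F t0 u0 R \<and> (\<forall>u. ivp_solution F t0 u0 u \<longrightarrow> (\<forall>t\<ge>t0. u t \<le> R t))"

end

theory Submission
  imports Defs
begin

text \<open>
  The function \<open>w = A (\<delta>\<psi> * \<delta>\<psi>)\<close> satisfies the strict differential inequality \<open>w' \<lless> \<phi> t w\<close>.
  At a first time at which some component of \<open>w\<close> catches up with \<open>R\<close>, quasi-monotonicity makes that
  component of \<open>R - w\<close> strictly increasing, which is absurd.  A nonzero \<open>j\<close>-th column of \<open>A\<close> bounds
  \<open>\<delta>\<psi>\<^sub>j\<^sup>2\<close> by a multiple of a component of \<open>R\<close>.
  As the Jacobian of \<open>f t\<close> is constant, \<open>f t\<close> is affine, and so the difference of two trajectories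
  solves the variational system.  To start it below \<open>R\<close> one rescales it; this needs a positive
  \<open>R\<close>, which is available at some time after \<open>t0\<close> even if \<open>u0\<close> has zero components, because the
  comparison hypothesis for the zero solution says \<open>0 \<lless> \<phi> t 0\<close>.
\<close>

section \<open>Quasi-monotonicity and strict comparison\<close>

lemma quasi_monotone_mono:
  fixes G :: "real ^ 'n \<Rightarrow> real ^ 'n"
  assumes G: "quasi_monotone G" and le: "u \<le> v" and eq: "u $ i = v $ i"
  shows "G u $ i \<le> G v $ i"
proof -
  \<comment> \<open>\<open>quasi_monotone\<close> moves one coordinate at a time, so the coordinates
    other than \<open>i\<close> are raised from \<open>u\<close> to \<open>v\<close> one by one;
    \<open>S\<close> holds those already raised.\<close>
  have "G u $ i \<le> G (\<chi> k. if k \<in> S then v $ k else u $ k) $ i" if "finite S" "i \<notin> S" for S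
    using that
  proof (induction S rule: finite_induct)
    case empty
    then show ?case by simp
  next
    case (insert j S)
    define x where "x = (\<chi> k. if k \<in> S then v $ k else u $ k)"
    have "j \<noteq> i" using insert.prems by blast
    then have "mono (\<lambda>s. G (\<chi> k. if k = j then s else x $ k) $ i)"
      by (rule G[unfolded quasi_monotone_def, rule_format])
    then have step: "G (\<chi> k. if k = j then u $ j else x $ k) $ i
        \<le> G (\<chi> k. if k = j then v $ j else x $ k) $ i"
      by (rule monoD) (use le in \<open>simp add: less_eq_vec_def\<close>)
    have old: "(\<chi> k. if k = j then u $ j else x $ k) = x"
      using insert.hyps by (auto simp: x_def vec_eq_iff)
    have new: "(\<chi> k. if k = j then v $ j else x $ k)
        = (\<chi> k. if k \<in> insert j S then v $ k else u $ k)"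
      by (auto simp: x_def vec_eq_iff)
    have "G u $ i \<le> G x $ i"
      unfolding x_def using insert.IH insert.prems by simp
    with step show ?case
      unfolding old new by (rule order_trans[rotated])
  qed
  from this[of "UNIV - {i}"] have "G u $ i \<le> G (\<chi> k. if k \<noteq> i then v $ k else u $ k) $ i"
    by simp
  moreover have "(\<chi> k. if k \<noteq> i then v $ k else u $ k) = v"
    using eq by (auto simp: vec_eq_iff)
  ultimately show ?thesis by simp
qed

lemma ode_solution_later:
  assumes "ode_solution F a x" "a \<le> b"
  shows "ode_solution F b x"
  using assms unfolding ode_solution_def
  by (meson atLeast_subset_iff has_vector_derivative_within_subset order_trans)

lemma ode_solution_component:
  fixes R :: "real \<Rightarrow> real ^ 'n"
  assumes "ode_solution F a R" "a \<le> t"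
  shows "((\<lambda>s. R s $ i) has_real_derivative F t (R t) $ i) (at t within {a..})"
  using assms bounded_linear.has_vector_derivative[OF bounded_linear_vec_nth]
  unfolding ode_solution_def has_real_derivative_iff_has_vector_derivative by blast

text \<open>The start \<open>a\<close> is kept free, because the convergence of trajectories needs
  the comparison from a time later than \<open>t0\<close>.\<close>

lemma strict_comparison:
  fixes w R :: "real \<Rightarrow> real ^ 'n"
  assumes qm: "\<And>t. t \<ge> a \<Longrightarrow> quasi_monotone (\<phi> t)"
    and dw: "\<And>t. t \<ge> a \<Longrightarrow> (w has_vector_derivative w' t) (at t within {a..})"
    and w': "\<And>t. t \<ge> a \<Longrightarrow> w' t \<lless> \<phi> t (w t)"
    and R: "ode_solution \<phi> a R"
    and init: "w a \<lless> R a"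
    and t: "t \<ge> a"
  shows "w t \<lless> R t"
proof (rule ccontr)
  assume "\<not> w t \<lless> R t"
  define d where "d i s = R s $ i - w s $ i" for i s
  have d_deriv: "(d i has_real_derivative \<phi> s (R s) $ i - w' s $ i) (at s within {a..})"
    if "s \<ge> a" for i s
    unfolding d_def
    using ode_solution_component[OF R that]
      bounded_linear.has_vector_derivative[OF bounded_linear_vec_nth dw[OF that]]
    by (intro DERIV_diff) (auto simp: has_real_derivative_iff_has_vector_derivative)
  then have d_cont: "continuous_on {a..} (d i)" for i
    by (intro DERIV_continuous_on[OF d_deriv]) simp
  \<comment> \<open>The times at which some component of \<open>w\<close> has reached
    \<open>R\<close>. As a finite union of closed sets, \<open>S\<close> contains its infimum, which
    is the first such time.\<close>
  define S where "S = (\<Union>i. {s \<in> {a..}. d i s \<le> 0})"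
  have "closed S"
    unfolding S_def
    by (intro closed_UN ballI finite_UNIV continuous_on_closed_Collect_le d_cont
        continuous_on_const closed_atLeast) simp
  moreover have "S \<noteq> {}"
    using \<open>\<not> w t \<lless> R t\<close> t by (auto simp: S_def vec_less_def d_def not_less)
  moreover have bdd: "bdd_below S"
    by (auto simp: S_def bdd_below_def)
  ultimately have "Inf S \<in> S"
    by (rule closed_contains_Inf[rotated 2])
  then obtain i where i: "d i (Inf S) \<le> 0" and Inf_ge: "Inf S \<ge> a"
    by (auto simp: S_def)
  have "Inf S \<noteq> a"
    using i init by (auto simp: d_def vec_less_def) (meson not_less)
  with Inf_ge have Inf_gt: "Inf S > a" by simp
  have before: "d j s > 0" if "a \<le> s" "s < Inf S" for j s
  proof (rule ccontr)
    assume "\<not> d j s > 0"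
    then have "s \<in> S" unfolding S_def using that(1) by (auto simp: not_less)
    from cInf_lower[OF this bdd] that show False by simp
  qed
  \<comment> \<open>Left limits of positive values. Together with \<open>i\<close> this yields w <=
    R at \<open>Inf S\<close> with equality in component \<open>i\<close>, just what
    quasi-monotonicity asks for.\<close>
  have at_Inf: "d j (Inf S) \<ge> 0" for j
  proof (rule tendsto_lowerbound)
    have "(d j \<longlongrightarrow> d j (Inf S)) (at (Inf S) within {a..})"
      using d_cont[of j] Inf_ge by (auto simp: continuous_on_def)
    then show "(d j \<longlongrightarrow> d j (Inf S)) (at (Inf S) within {a..<Inf S})"
      by (rule tendsto_within_subset) auto
    show "\<forall>\<^sub>F s in at (Inf S) within {a..<Inf S}. 0 \<le> d j s"
      using before by (auto simp: eventually_at_filter intro!: always_eventually less_imp_le)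
    show "at (Inf S) within {a..<Inf S} \<noteq> bot"
      using Inf_gt by (simp add: at_within_eq_bot_iff)
  qed
  have "\<phi> (Inf S) (w (Inf S)) $ i \<le> \<phi> (Inf S) (R (Inf S)) $ i"
    using at_Inf i at_Inf[of i]
    by (intro quasi_monotone_mono[OF qm[OF Inf_ge]]) (auto simp: d_def less_eq_vec_def intro: antisym)
  then have "0 < \<phi> (Inf S) (R (Inf S)) $ i - w' (Inf S) $ i"
    using w'[OF Inf_ge] by (auto simp: vec_less_def) (meson less_le_trans)
  from has_real_derivative_pos_inc_left[OF d_deriv[OF Inf_ge] this]
  obtain e where e: "e > 0" "\<And>h. h > 0 \<Longrightarrow> Inf S - h \<in> {a..} \<Longrightarrow> h < e \<Longrightarrow> d i (Inf S - h) < d i (Inf S)"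
    by blast
  \<comment> \<open>The first bound keeps the step below \<open>e\<close>, the second keeps
    \<open>Inf S - \<eta>\<close> at or after \<open>a\<close>. There \<open>d i\<close> would be
    both negative and positive.\<close>
  define \<eta> where "\<eta> = min (e / 2) (Inf S - a)"
  have "d i (Inf S - \<eta>) < d i (Inf S)" "d i (Inf S - \<eta>) > 0"
    using e Inf_gt by (auto simp: \<eta>_def intro!: e(2) before)
  with i show False by simp
qed

text \<open>A positive component stays positive for a while by continuity. A zero component has
  positive derivative, since quasi-monotonicity compares \<open>F a (R a)\<close> with
  \<open>F a 0\<close> in that component.\<close>

lemma positive_after_initial_time:
  fixes R :: "real \<Rightarrow> real ^ 'n"
  assumes qm: "quasi_monotone (F a)" and pos: "0 \<lless> F a 0"
    and R: "ode_solution F a R" and nonneg: "R a \<ge> 0"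
  obtains b where "b > a" "0 \<lless> R b"
proof -
  have "\<forall>\<^sub>F s in at_right a. R s $ i > 0" for i
  proof (cases "R a $ i = 0")
    case True
    have "0 < F a 0 $ i" using pos by (simp add: vec_less_def)
    also have "\<dots> \<le> F a (R a) $ i"
      using nonneg True by (intro quasi_monotone_mono qm) auto
    finally have "0 < F a (R a) $ i" .
    from has_real_derivative_pos_inc_right[OF ode_solution_component[OF R order_refl] this]
    obtain e where "e > 0" and e: "\<And>h. h > 0 \<Longrightarrow> h < e \<Longrightarrow> R a $ i < R (a + h) $ i"
      by auto
    have "R s $ i > 0" if "a < s" "s < a + e" for s
      using e[of "s - a"] that True by simp
    with \<open>e > 0\<close> show ?thesis
      unfolding eventually_at_right_field by (intro exI[of _ "a + e"]) auto
  next
    case False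
    then have "R a $ i > 0" using nonneg by (simp add: less_eq_vec_def order_less_le)
    moreover have "((\<lambda>s. R s $ i) \<longlongrightarrow> R a $ i) (at a within {a..})"
      using DERIV_continuous[OF ode_solution_component[OF R order_refl]]
      by (simp add: continuous_within)
    then have "((\<lambda>s. R s $ i) \<longlongrightarrow> R a $ i) (at_right a)"
      by (rule tendsto_within_subset) auto
    ultimately show ?thesis by (rule order_tendstoD(1)[rotated])
  qed
  then have "\<forall>\<^sub>F s in at_right a. s > a \<and> (\<forall>i. R s $ i > 0)"
    by (intro eventually_conj eventually_all_finite) (auto simp: eventually_at_right_less)
  then obtain b where "b > a" "\<forall>i. R b $ i > 0"
    using eventually_happens' trivial_limit_at_right_real by blast
  then show ?thesis using that by (simp add: vec_less_def)
qed

section \<open>The quadratic quantity \<open>A *v (x * x)\<close>\<close>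

lemma matrix_square_has_vector_derivative:
  fixes x :: "real \<Rightarrow> real ^ 'n" and A :: "real ^ 'n ^ 'm"
  assumes "(x has_vector_derivative x') (at t within S)"
  shows "((\<lambda>s. A *v (x s * x s)) has_vector_derivative 2 *\<^sub>R (A *v (x t * x'))) (at t within S)"
proof -
  have comp: "((\<lambda>s. x s $ j) has_real_derivative x' $ j) (at t within S)" for j
    using bounded_linear.has_vector_derivative[OF bounded_linear_vec_nth assms]
    by (simp add: has_real_derivative_iff_has_vector_derivative)
  have "((\<lambda>s. \<Sum>j\<in>UNIV. A $ i $ j * (x s $ j * x s $ j)) has_real_derivative
      (\<Sum>j\<in>UNIV. A $ i $ j * (x' $ j * x t $ j + x' $ j * x t $ j))) (at t within S)" for i
    by (intro DERIV_sum DERIV_cmult DERIV_mult comp)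
  moreover have "(\<Sum>j\<in>UNIV. A $ i $ j * (x' $ j * x t $ j + x' $ j * x t $ j))
      = (2 *\<^sub>R (A *v (x t * x'))) $ i" for i
    by (simp add: matrix_vector_mult_def sum_distrib_left algebra_simps)
  ultimately have "((\<lambda>s. (A *v (x s * x s)) $ i) has_real_derivative
      (2 *\<^sub>R (A *v (x t * x'))) $ i) (at t within S)" for i
    by (simp add: matrix_vector_mult_def)
  then have "((\<lambda>s. (A *v (x s * x s)) $ i) has_derivative
      (\<lambda>v. (v *\<^sub>R 2 *\<^sub>R (A *v (x t * x'))) $ i)) (at t within S)" for i
    by (simp add: has_field_derivative_def mult_commute_abs[of "2 * _"] mult.assoc)
  then show ?thesis
    unfolding has_vector_derivative_def
    by (subst has_derivative_componentwise_within)
      (auto simp: Basis_vec_def inner_axis)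
qed

text \<open>With nonnegative entries, a single term \<open>A $ i $ j * (x t $ j)\<^sup>2\<close> is
  at most the whole \<open>i\<close>-th component. A zero column \<open>j\<close> would remove
  \<open>x t $ j\<close> from the bound altogether, hence the condition on columns.\<close>

lemma norm_tendsto_zero_of_matrix_square_bound:
  fixes x :: "'b \<Rightarrow> real ^ 'n" and A :: "real ^ 'n ^ 'm"
  assumes A: "\<And>i j. A $ i $ j \<ge> 0" and col: "\<And>j. column j A \<noteq> 0"
    and le: "\<forall>\<^sub>F t in F. A *v (x t * x t) \<le> R t" and R: "(R \<longlongrightarrow> 0) F"
  shows "((\<lambda>t. norm (x t)) \<longlongrightarrow> 0) F"
proof (intro tendsto_norm_zero vec_tendstoI)
  fix j
  obtain i where "A $ i $ j \<noteq> 0"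
    using col[of j] by (auto simp: column_def vec_eq_iff)
  then have pos: "A $ i $ j > 0" using A[of i j] by simp
  have "\<forall>\<^sub>F t in F. (x t $ j)\<^sup>2 \<le> R t $ i / A $ i $ j"
    using le
  proof eventually_elim
    case (elim t)
    have "A $ i $ j * (x t $ j)\<^sup>2 \<le> (\<Sum>k\<in>UNIV. A $ i $ k * (x t $ k)\<^sup>2)"
      using A by (intro member_le_sum[where f = "\<lambda>k. A $ i $ k * (x t $ k)\<^sup>2"]) simp_all
    also have "\<dots> = (A *v (x t * x t)) $ i"
      by (simp add: matrix_vector_mult_def power2_eq_square)
    also have "\<dots> \<le> R t $ i" using elim by (simp add: less_eq_vec_def)
    finally show ?case using pos by (simp add: field_simps)
  qed
  moreover have "((\<lambda>t. R t $ i / A $ i $ j) \<longlongrightarrow> 0) F"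
    using tendsto_vec_nth[OF R, of i] by (intro tendsto_divide_zero) simp
  ultimately have "((\<lambda>t. (x t $ j)\<^sup>2) \<longlongrightarrow> 0) F"
    by (rule tendsto_sandwich[OF _ _ tendsto_const, rotated]) simp
  then have "((\<lambda>t. sqrt ((x t $ j)\<^sup>2)) \<longlongrightarrow> sqrt 0) F"
    by (rule tendsto_real_sqrt)
  then show "((\<lambda>t. x t $ j) \<longlongrightarrow> 0 $ j) F"
    by (simp add: tendsto_rabs_zero_iff)
qed

section \<open>Affine right-hand sides and rescaling\<close>

lemma continuously_differentiable_on_section:
  assumes "continuously_differentiable_on (\<lambda>(t, x). f t x) (T \<times> UNIV)" "t \<in> T"
  shows "f t differentiable (at x)"
proof -
  obtain g' where "((\<lambda>(t, x). f t x) has_derivative g') (at (t, x) within T \<times> UNIV)"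
    using assms unfolding continuously_differentiable_on_def by blast
  moreover have "((\<lambda>y. (t, y)) has_derivative (\<lambda>v. (0, v))) (at x)"
    by (rule has_derivative_Pair[OF has_derivative_const has_derivative_ident])
  \<comment> \<open>The section never leaves the set, so a derivative within it becomes a full
    derivative in \<open>x\<close>, even when \<open>t\<close> is a boundary point of
    \<open>T\<close>.\<close>
  moreover have "range (\<lambda>y. (t, y)) \<subseteq> T \<times> UNIV" using assms(2) by auto
  ultimately have "((\<lambda>y. (\<lambda>(t, x). f t x) (t, y)) has_derivative (\<lambda>v. g' (0, v))) (at x)"
    by (metis has_derivative_in_compose has_derivative_subset)
  then show ?thesis unfolding differentiable_def by auto
qed

text \<open>\<open>g - L\<close> has derivative zero everywhere and is therefore constant.\<close>

lemma constant_jacobian_affine: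
  fixes g :: "real ^ 'n \<Rightarrow> real ^ 'm"
  assumes diff: "\<And>x. g differentiable (at x)" and J: "\<And>x v. L v = jacobian g (at x) *v v"
  shows "g x - g y = L (x - y)"
proof -
  have L: "L = (\<lambda>v. jacobian g (at 0) *v v)" using J by blast
  have "(g has_derivative L) (at z)" for z
    using diff[of z] J[of _ z] jacobian_works[of g "at z"] by (metis (full_types) ext)
  moreover have "(L has_derivative L) (at z)" for z
    unfolding L by (intro bounded_linear_imp_has_derivative matrix_vector_mul_bounded_linear)
  ultimately have "((\<lambda>z. g z - L z) has_derivative (\<lambda>v. 0)) (at z)" for z
    using has_derivative_diff[of g L "at z" L L] by simp
  then have "g x - L x = g y - L y"
    using has_derivative_zero_unique[of UNIV "\<lambda>z. g z - L z"] by auto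
  then show ?thesis
    unfolding L by (simp add: matrix_vector_mult_diff_distrib algebra_simps)
qed

text \<open>As c tends to 0 from the right, each of the finitely many components of
  \<open>c *\<^sub>R v\<close> tends to 0, so one small c serves them all.\<close>

lemma small_multiple_vec_less:
  fixes v R :: "real ^ 'n"
  assumes "0 \<lless> R"
  obtains c :: real where "c > 0" "c *\<^sub>R v \<lless> R"
proof -
  have "\<forall>\<^sub>F c in at_right (0::real). c * v $ i < R $ i" for i
  proof (rule order_tendstoD(2))
    show "((\<lambda>c. c * v $ i) \<longlongrightarrow> 0) (at_right 0)"
      by (auto intro!: tendsto_eq_intros)
    show "0 < R $ i" using assms by (simp add: vec_less_def)
  qed
  then have "\<forall>\<^sub>F c in at_right (0::real). c > 0 \<and> (\<forall>i. c * v $ i < R $ i)"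
    by (intro eventually_conj eventually_all_finite) (auto simp: eventually_at_right_less)
  then obtain c where "c > 0" "\<forall>i. c * v $ i < R $ i"
    using eventually_happens' trivial_limit_at_right_real by blast
  then show ?thesis using that by (simp add: vec_less_def)
qed

section \<open>Comparison bound and convergence of trajectories\<close>

theorem theorem2:
  fixes f :: "real \<Rightarrow> real ^ 'n \<Rightarrow> real ^ 'n"
    and h :: "real ^ 'n \<Rightarrow> real \<Rightarrow> real ^ 'n"
    and \<phi> :: "real \<Rightarrow> real ^ 'n \<Rightarrow> real ^ 'n"
    and A :: "real ^ 'n ^ 'n"
    and R :: "real \<Rightarrow> real ^ 'n"
    and u0 :: "real ^ 'n"
    and t0 :: real
  assumes f_C1: "continuously_differentiable_on (\<lambda>(t, x). f t x) ({0..} \<times> UNIV)"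
    and t0_pos: "t0 > 0"
    and unique_solution: "\<And>x0. \<exists>\<psi>. ivp_solution f t0 x0 \<psi> \<and>
      (\<forall>x. ivp_solution f t0 x0 x \<longrightarrow> (\<forall>t\<ge>t0. x t = \<psi> t))"
    and h_jacobian: "\<And>t x v. t \<ge> 0 \<Longrightarrow> h v t = jacobian (f t) (at x) *v v"
    and phi_cont: "continuous_on ({0..} \<times> UNIV) (\<lambda>(t, u). \<phi> t u)"
    and phi_quasi_monotone: "\<And>t. t \<ge> 0 \<Longrightarrow> quasi_monotone (\<phi> t)"
    and A_nonzero: "A \<noteq> 0"
    and A_nonneg: "\<And>i j. A $ i $ j \<ge> 0"
    and comparison: "\<And>\<delta>\<psi> t. ode_solution (\<lambda>t v. h v t) t0 \<delta>\<psi> \<Longrightarrow> t \<ge> t0 \<Longrightarrow>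
      2 *\<^sub>R (A *v (\<delta>\<psi> t * h (\<delta>\<psi> t) t)) \<lless> \<phi> t (A *v (\<delta>\<psi> t * \<delta>\<psi> t))"
    and u0_nonneg: "u0 \<ge> 0"
    and R_maximal: "maximal_solution \<phi> t0 u0 R"
  shows "(\<forall>\<delta>x0 \<delta>\<psi>. ivp_solution (\<lambda>t v. h v t) t0 \<delta>x0 \<delta>\<psi> \<and> A *v (\<delta>x0 * \<delta>x0) \<lless> u0 \<longrightarrow>
            (\<forall>t\<ge>t0. A *v (\<delta>\<psi> t * \<delta>\<psi> t) \<lless> R t)) \<and>
         ((\<forall>j. column j A \<noteq> 0) \<and> (R \<longlongrightarrow> 0) at_top \<longrightarrow>
            (\<forall>\<delta>x0 \<delta>\<psi>. ivp_solution (\<lambda>t v. h v t) t0 \<delta>x0 \<delta>\<psi> \<and> A *v (\<delta>x0 * \<delta>x0) \<lless> u0 \<longrightarrow>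
               ((\<lambda>t. norm (\<delta>\<psi> t)) \<longlongrightarrow> 0) at_top) \<and>
            (\<forall>x y. ode_solution f t0 x \<and> ode_solution f t0 y \<longrightarrow>
               ((\<lambda>t. norm (x t - y t)) \<longlongrightarrow> 0) at_top))"
proof -
  have R: "ode_solution \<phi> t0 R" and R0: "R t0 = u0"
    using R_maximal by (auto simp: maximal_solution_def ivp_solution_def)
  \<comment> \<open>The comparison may start at any \<open>a\<close> from \<open>t0\<close> on, but
    \<open>x\<close> must solve the variational system from \<open>t0\<close>, as
    \<open>comparison\<close> speaks only of such solutions.\<close>
  have bound: "A *v (x t * x t) \<lless> R t"
    if x: "ode_solution (\<lambda>t v. h v t) t0 x" and a: "a \<ge> t0" "A *v (x a * x a) \<lless> R a"
      and t: "t \<ge> a" for x a t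
  proof (rule strict_comparison[where w = "\<lambda>t. A *v (x t * x t)" and \<phi> = \<phi> and a = a])
    show "((\<lambda>t. A *v (x t * x t)) has_vector_derivative 2 *\<^sub>R (A *v (x s * h (x s) s)))
        (at s within {a..})" if "s \<ge> a" for s
      using ode_solution_later[OF x a(1)] that
      by (intro matrix_square_has_vector_derivative) (auto simp: ode_solution_def)
  qed (use a t t0_pos phi_quasi_monotone comparison[OF x] ode_solution_later[OF R] in auto)
  have vanish: "((\<lambda>t. norm (x t)) \<longlongrightarrow> 0) at_top"
    if x: "ode_solution (\<lambda>t v. h v t) t0 x" and a: "a \<ge> t0" "A *v (x a * x a) \<lless> R a"
      and "\<forall>j. column j A \<noteq> 0" "(R \<longlongrightarrow> 0) at_top" for x a
  proof (rule norm_tendsto_zero_of_matrix_square_bound)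
    show "\<forall>\<^sub>F t in at_top. A *v (x t * x t) \<le> R t"
      using eventually_ge_at_top[of a]
      by eventually_elim
        (use bound[OF x a] in \<open>auto simp: vec_less_def less_eq_vec_def intro: less_imp_le\<close>)
  qed (use that A_nonneg in auto)
  have h_scale: "h (c *\<^sub>R v) t = c *\<^sub>R h v t" if "t \<ge> 0" for c v t
    using h_jacobian[OF that, where x = 0] by (simp add: matrix_vector_mult_scaleR)
  have f_diff: "f t x - f t y = h (x - y) t" if "t \<ge> 0" for t x y
    by (rule constant_jacobian_affine[where g = "f t" and L = "\<lambda>v. h v t"])
      (use that h_jacobian continuously_differentiable_on_section[OF f_C1] in auto)
  have converge: "((\<lambda>t. norm (x t - y t)) \<longlongrightarrow> 0) at_top"
    if x: "ode_solution f t0 x" and y: "ode_solution f t0 y"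
      and lim: "\<forall>j. column j A \<noteq> 0" "(R \<longlongrightarrow> 0) at_top" for x y
  proof -
    \<comment> \<open>Scaling by 0 gives \<open>h 0 t = 0\<close>; for this solution both products
      with \<open>A\<close> in \<open>comparison\<close> vanish.\<close>
    have zero_sol: "ode_solution (\<lambda>t v. h v t) t0 (\<lambda>t. 0)"
      using t0_pos h_scale[of _ 0 0] by (simp add: ode_solution_def)
    have "0 \<lless> \<phi> t0 0"
      using comparison[OF zero_sol order_refl] by simp
    moreover have "quasi_monotone (\<phi> t0)" "R t0 \<ge> 0"
      using phi_quasi_monotone t0_pos R0 u0_nonneg by auto
    ultimately obtain b where b: "b > t0" "0 \<lless> R b"
      using positive_after_initial_time R by metis
    obtain c where c: "c > 0" "c *\<^sub>R (A *v ((x b - y b) * (x b - y b))) \<lless> R b"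
      using small_multiple_vec_less[OF b(2)] by blast
    \<comment> \<open>The square root, because \<open>A *v (z b * z b)\<close> is quadratic in
      \<open>z\<close> and so picks up exactly the factor \<open>c\<close>.\<close>
    define z where "z t = sqrt c *\<^sub>R (x t - y t)" for t
    have "ode_solution (\<lambda>t v. h v t) t0 z"
      unfolding ode_solution_def
    proof (intro allI impI)
      fix t assume t: "t \<ge> t0"
      have "((\<lambda>t. x t - y t) has_vector_derivative f t (x t) - f t (y t)) (at t within {t0..})"
        using x y t by (intro has_vector_derivative_diff) (auto simp: ode_solution_def)
      then have "(z has_vector_derivative sqrt c *\<^sub>R (f t (x t) - f t (y t))) (at t within {t0..})"
        unfolding z_def
        by (rule bounded_linear.has_vector_derivative[OF bounded_linear_scaleR_right])
      then show "(z has_vector_derivative h (z t) t) (at t within {t0..})"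
        using t t0_pos by (simp add: z_def f_diff h_scale)
    qed
    moreover have "A *v (z b * z b) \<lless> R b"
      using c by (simp add: z_def matrix_vector_mult_scaleR)
    \<comment> \<open>\<open>z\<close> starts below \<open>R\<close> at time \<open>b\<close>, so it
      vanishes in the limit; dividing by the constant \<open>sqrt c\<close> carries this over to
      \<open>x - y\<close>.\<close>
    ultimately have "((\<lambda>t. norm (z t)) \<longlongrightarrow> 0) at_top"
      using vanish lim b(1) by (meson less_imp_le)
    then have "((\<lambda>t. norm (z t) / sqrt c) \<longlongrightarrow> 0) at_top"
      by (rule tendsto_divide_zero)
    then show ?thesis using c(1) by (simp add: z_def)
  qed
  \<comment> \<open>For the claims about the variational system the comparison starts at
    \<open>t0\<close> itself, where \<open>R\<close> equals \<open>u0\<close>.\<close>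
  show ?thesis
    using bound[OF _ order_refl] vanish[OF _ order_refl] converge
    by (auto simp: ivp_solution_def R0)
qed

end
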